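(* Let $s=2$, $p=1$, $q\ge 3$ and $n=p+q+1$. Then the following $(p+q)\times n$ matrix over $\mathrm{GF}(2)$, whose first row is $\mathcal{G}_c$ and whose last $q$ rows form $\mathcal{G}_r$, yields a 2fi-optimal $2^{n-1}$ fractional factorial row-column design (in a $2^p\times 2^q$ array): $$\mathcal{G}=\left(\begin{array}{ccc} 1 & \boldsymbol{1}_q^T & 1\\ \hline \boldsymbol{1}_q & I_q+J_q & \boldsymbol{e}_q\end{array}\right).$$
   Context: Matrices. $s$ is a prime (here $s=2$) and all matrices have entries in $\mathrm{GF}(s)=\mathbb{Z}/s$ (integers are reduced mod $s$). $I_v$ is the $v\times v$ identity, $J_v$ the $v\times v$ all-ones matrix, $\boldsymbol{1}_v$ the $v\times1$ all-ones vector, and $\boldsymbol{e}_i$ the column vector (here of length $q$) with $i$-th entry $1$ and other entries $0$. Designs. Let $p,q\ge1$, $p+q\le n$. An array generator matrix is a $(p+q)\times n$ matrix $\mathcal{G}$ over $\mathrm{GF}(s)$ of full row rank $p+q$; $\mathcal{G}_c$ denotes its first $p$ rows, $\mathcal{G}_r$ its last $q$ rows, and $\mathcal{G}_i,\mathcal{G}_{c,i},\mathcal{G}_{r,i}$ the $i$-th columns of $\mathcal{G},\mathcal{G}_c,\mathcal{G}_r$. If $\boldsymbol{x}_1,\dots,\boldsymbol{x}_{s^p}$ are the vectors of the row space of $\mathcal{G}_c$ and $\boldsymbol{y}_1,\dots,\boldsymbol{y}_{s^q}$ those of the row space of $\mathcal{G}_r$ (with $\boldsymbol{x}_1=\boldsymbol{y}_1=0$),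 $\mathcal{G}$ yields the $s^p\times s^q$ row-column design whose cell $(i,j)$ carries the level combination $d[i,j]=\boldsymbol{x}_i+\boldsymbol{y}_j\in\mathrm{GF}(s)^n$ of the $n$ factors $F_1,\dots,F_n$. It is an $s^n$ full factorial design when $p+q=n$, and an $s^{n-k}$ fractional factorial design when $p+q=n-k<n$. Model and confounding. $Y_{ij}=\mu+\tau_i+\rho_j+\gamma_{d[i,j]}+\varepsilon_{ij}$, with row effects $\tau_i$, column effects $\rho_j$, uncorrelated mean-zero errors of variance $\sigma^2$, and $\gamma_{(x_1,\dots,x_n)}=\sum_l\alpha_{l,x_l}+\sum_{l<m}\sum_{v=1}^{s-1}\beta^{(v)}_{lm,\,x_l+vx_m}$, where $\sum_u\alpha_{l,u}=0$ and $\sum_u\beta^{(v)}_{lm,u}=0$. A main effect $F_l$ is unconfounded if the estimators of the $\alpha_{l,u}$ are uncorrelated with all other estimators in the model; the two-factor interaction (2fi) $F_l\times F_m$ is unconfounded if for every $v=1,\dots,s-1$ the estimators of the $\beta^{(v)}_{lm,u}$ are uncorrelated with all other estimators in the model. Interactions of three or more factors are assumed negligible. Equivalent algebraic criterion (known result, Zhou and Zhou 2023), usable as the definition of confounding. A main effect or 2fi is confounded with another main effect or 2fi iff the columns of $\mathcal{G}$ corresponding to the (distinct) factors involved in the two effects are linearly dependent. If $\mathcal{G}_i\ne0$, $F_i$ is confounded with column effects iff $\mathcal{G}_{c,i}=0$, and with row effects iff $\mathcal{G}_{r,i}=0$. If $\mathcal{G}_i,\mathcal{G}_j$ are linearly independent,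 $F_i\times F_j$ is confounded with column effects iff $\mathcal{G}_{c,i},\mathcal{G}_{c,j}$ are linearly dependent, and with row effects iff $\mathcal{G}_{r,i},\mathcal{G}_{r,j}$ are linearly dependent. An effect is unconfounded iff none of these confoundings occurs. 2fi-optimality. The design yielded by $\mathcal{G}$ is 2fi-optimal if all main effects are unconfounded and the number of unconfounded 2fi's is maximum among all designs yielded by array generator matrices with the same $(s,p,q,n)$ for which all main effects are unconfounded. *)

theory Defs
  imports "HOL-Library.Z2" "HOL-Library.Cardinality" "Jordan_Normal_Form.DL_Rank"
begin

text \<open>
  The field GF(s) is a field type \<open>'a\<close> with \<open>CARD('a) = s\<close>; for \<open>s = 2\<close> it is \<^typ>\<open>bit\<close>.
  Factors, rows and columns are numbered from \<open>0\<close>: the factors are \<open>0, \<dots>, n - 1\<close>.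
\<close>

definition array_generator :: "nat \<Rightarrow> nat \<Rightarrow> nat \<Rightarrow> 'a::field mat \<Rightarrow> bool" where
  "array_generator p q n G \<longleftrightarrow>
     1 \<le> p \<and> 1 \<le> q \<and> p + q \<le> n \<and> G \<in> carrier_mat (p + q) n \<and> vec_space.rank (p + q) G = p + q"

definition gen_c :: "nat \<Rightarrow> 'a mat \<Rightarrow> 'a mat" where
  "gen_c p G = mat p (dim_col G) (\<lambda>(i, j). G $$ (i, j))"

definition gen_r :: "nat \<Rightarrow> 'a mat \<Rightarrow> 'a mat" where
  "gen_r p G = mat (dim_row G - p) (dim_col G) (\<lambda>(i, j). G $$ (p + i, j))"

text \<open>
  A design is given by its cells: \<open>d i j\<close> is the level combination in cell \<open>(i, j)\<close> of the array.
  The order in which the two row spaces are enumerated is arbitrary, except that both enumerations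
  start with the zero vector, so \<open>G\<close> determines \<open>d\<close> up to a permutation of rows and columns.
\<close>

definition yields_design ::
  "nat \<Rightarrow> nat \<Rightarrow> nat \<Rightarrow> 'a::field mat \<Rightarrow> (nat \<Rightarrow> nat \<Rightarrow> 'a vec) \<Rightarrow> bool" where
  "yields_design p q n G d \<longleftrightarrow>
     (\<exists>x y. bij_betw x {..<CARD('a) ^ p} (vec_space.row_space n (gen_c p G)) \<and> x 0 = 0\<^sub>v n \<and>
            bij_betw y {..<CARD('a) ^ q} (vec_space.row_space n (gen_r p G)) \<and> y 0 = 0\<^sub>v n \<and>
            (\<forall>i < CARD('a) ^ p. \<forall>j < CARD('a) ^ q. d i j = x i + y j))"

text \<open>The matrix \<open>G\<close> gives an \<open>s^(n - k)\<close> fractional factorial design, with \<open>k \<ge> 1\<close>.\<close>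

definition fractional_factorial :: "nat \<Rightarrow> nat \<Rightarrow> nat \<Rightarrow> nat \<Rightarrow> 'a::field mat \<Rightarrow> bool" where
  "fractional_factorial p q n k G \<longleftrightarrow>
     array_generator p q n G \<and> k \<le> n \<and> p + q = n - k \<and> n - k < n"

text \<open>
  Linear dependence of the indexed family of columns \<open>(A\<^sub>i)\<close>, \<open>i \<in> I\<close>.  It is not
  expressed by a set of vectors because two equal columns with different indices are dependent.
\<close>

definition cols_dependent :: "'a::field mat \<Rightarrow> nat set \<Rightarrow> bool" where
  "cols_dependent A I \<longleftrightarrow>
     (\<exists>c. (\<exists>i\<in>I. c i \<noteq> 0) \<and> (\<forall>r < dim_row A. (\<Sum>i\<in>I. c i * A $$ (r, i)) = 0))"

text \<open>
  An effect is the set of factors that it involves: one factor for a main effect, two for a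
  two-factor interaction (2fi).
\<close>

definition main_effects :: "nat \<Rightarrow> nat set set" where
  "main_effects n = {{i} | i. i < n}"

definition two_fis :: "nat \<Rightarrow> nat set set" where
  "two_fis n = {{i, j} | i j. i < n \<and> j < n \<and> i \<noteq> j}"

definition confounded :: "'a::field mat \<Rightarrow> nat set \<Rightarrow> nat set \<Rightarrow> bool" where
  "confounded G E E' \<longleftrightarrow> cols_dependent G (E \<union> E')"

text \<open>
  Confounding with column (row) effects: for \<open>E = {i}\<close> the condition is that the column \<open>i\<close> of
  the block is zero, for \<open>E = {i, j}\<close> that the columns \<open>i\<close> and \<open>j\<close> of the block are dependent.
  The known criterion is stated for effects whose columns in \<open>G\<close> are independent. The other effects
  are confounded with some main effect or 2fi anyway as soon as \<open>n \<ge> 2\<close>, so the value chosen here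
  for them does not affect \<open>unconfounded\<close>.
\<close>

definition confounded_col_effects :: "nat \<Rightarrow> 'a::field mat \<Rightarrow> nat set \<Rightarrow> bool" where
  "confounded_col_effects p G E \<longleftrightarrow>
     (\<exists>i. E = {i} \<and> col (gen_c p G) i = 0\<^sub>v p) \<or>
     (\<exists>i j. i \<noteq> j \<and> E = {i, j} \<and> cols_dependent (gen_c p G) {i, j})"

definition confounded_row_effects :: "nat \<Rightarrow> 'a::field mat \<Rightarrow> nat set \<Rightarrow> bool" where
  "confounded_row_effects p G E \<longleftrightarrow>
     (\<exists>i. E = {i} \<and> col (gen_r p G) i = 0\<^sub>v (dim_row G - p)) \<or>
     (\<exists>i j. i \<noteq> j \<and> E = {i, j} \<and> cols_dependent (gen_r p G) {i, j})"

definition unconfounded :: "nat \<Rightarrow> nat \<Rightarrow> 'a::field mat \<Rightarrow> nat set \<Rightarrow> bool" where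
  "unconfounded p n G E \<longleftrightarrow>
     (\<forall>E' \<in> main_effects n \<union> two_fis n. E' \<noteq> E \<longrightarrow> \<not> confounded G E E') \<and>
     \<not> confounded_col_effects p G E \<and> \<not> confounded_row_effects p G E"

definition main_effects_unconfounded :: "nat \<Rightarrow> nat \<Rightarrow> 'a::field mat \<Rightarrow> bool" where
  "main_effects_unconfounded p n G \<longleftrightarrow> (\<forall>E \<in> main_effects n. unconfounded p n G E)"

definition num_unconfounded_2fis :: "nat \<Rightarrow> nat \<Rightarrow> 'a::field mat \<Rightarrow> nat" where
  "num_unconfounded_2fis p n G = card {E \<in> two_fis n. unconfounded p n G E}"

definition two_fi_optimal :: "nat \<Rightarrow> nat \<Rightarrow> nat \<Rightarrow> 'a::field mat \<Rightarrow> bool" where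
  "two_fi_optimal p q n G \<longleftrightarrow>
     array_generator p q n G \<and> main_effects_unconfounded p n G \<and>
     (\<forall>H :: 'a mat. array_generator p q n H \<and> main_effects_unconfounded p n H \<longrightarrow>
        num_unconfounded_2fis p n H \<le> num_unconfounded_2fis p n G)"

definition ones_mat :: "nat \<Rightarrow> nat \<Rightarrow> 'a::one mat" where
  "ones_mat m n = mat m n (\<lambda>_. 1)"

definition ones_vec :: "nat \<Rightarrow> 'a::one vec" where
  "ones_vec m = vec m (\<lambda>_. 1)"

text \<open>The last column of the lower block is \<open>e\<^sub>q\<close>, whose nonzero entry has index \<open>q - 1\<close> here.\<close>

definition one_row_generator :: "nat \<Rightarrow> bit mat" where
  "one_row_generator q =
     mat_of_cols 1 ([ones_vec 1] @ cols (ones_mat 1 q) @ [ones_vec 1]) @\<^sub>r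
     mat_of_cols q ([ones_vec q] @ cols (1\<^sub>m q + ones_mat q q) @ [unit_vec q (q - 1)])"

end

theory Submission
  imports Defs
begin

text \<open>
  Three things have to be seen: that the matrix is an array generator and hence yields a design,
  that all main effects of this design are unconfounded, and that no competing design has more
  unconfounded two-factor interactions.

  The last point is decided by \<open>p = 1\<close>. Any two columns of the block \<open>\<G>\<^sub>c\<close> lie in a
  one-dimensional space and are therefore dependent, so every two-factor interaction is confounded
  with column effects (\<open>no_unconfounded_2fis_one_row\<close>). The maximum is thus \<open>0\<close>, and
  two-factor optimality amounts to unconfounded main effects.

  For the main effects, all entries in the first row of the matrix are \<open>1\<close>. A vanishing sum of
  columns over \<open>GF(2)\<close> therefore has an even number of terms. A main effect and another main
  effect or two-factor interaction involve at most three factors, so a dependence between them could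
  only be an equality of two columns (\<open>at_most_three_cols_independent\<close>). It remains to
  see that the columns are distinct and that none of them vanishes below the first row; for
  \<open>q \<ge> 3\<close> this can be read off from the entries.

  For the rank, let \<open>g\<^sub>0, \<dots>, g\<^bsub>q+1\<^esub>\<close> be the columns, and number the unit vectors of length
  \<open>q + 1\<close> from \<open>0\<close>. Then \<open>g\<^sub>0 + g\<^sub>i\<close> is the unit vector \<open>i\<close> for \<open>1 \<le> i \<le> q\<close>, and adding
  the unit vector \<open>q\<close> to \<open>g\<^bsub>q+1\<^esub>\<close> gives the unit vector \<open>0\<close>, so the columns span the whole
  space. Full row rank makes both blocks surjective as linear maps, hence their transposes
  injective, so the row spaces have exactly \<open>2^p\<close> and \<open>2^q\<close> elements and can be enumerated as a
  design requires (\<open>array_generator_yields_design\<close>).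
\<close>

section \<open>Full row rank and enumerations of the row spaces\<close>

text \<open>
  A maximal independent set of columns has as many elements as the rank; if there are \<open>n\<close> of them,
  they form a basis of the whole space.
\<close>

lemma (in vec_space) rank_eq_dim_iff_col_space:
  assumes A: "A \<in> carrier_mat n nc"
  shows "rank A = n \<longleftrightarrow> col_space A = carrier_vec n"
proof
  have sub: "set (cols A) \<subseteq> carrier_vec n"
    using A cols_dim by blast
  assume r: "rank A = n"
  obtain S where S: "maximal S (\<lambda>T. T \<subseteq> set (cols A) \<and> lin_indpt T)"
    using maximal_exists_superset[of "set (cols A)" "\<lambda>T. T \<subseteq> set (cols A) \<and> lin_indpt T" "{}"]
    by (metis List.finite_set empty_subsetI finite_lin_indpt2 finite.emptyI equals0D)
  have SA: "S \<subseteq> set (cols A)" and li: "lin_indpt S"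
    using S by (auto simp: maximal_def)
  have "card S = n"
    using rank_card_indpt[OF A S] r by simp
  then have "basis S"
    using dim_li_is_basis[of S] SA li sub fin_dim finite_subset[OF SA] dim_is_n by auto
  then have "carrier_vec n \<subseteq> span S"
    unfolding basis_def by auto
  also have "\<dots> \<subseteq> col_space A"
    unfolding col_space_def by (rule span_is_monotone[OF SA])
  finally show "col_space A = carrier_vec n"
    unfolding col_space_def using span_closed[OF sub[folded carrier_vs_is_self]] by auto
next
  assume "col_space A = carrier_vec n"
  then have "span_vs (set (cols A)) = V"
    unfolding col_space_def by simp
  then show "rank A = n"
    unfolding rank_def by (simp add: dim_is_n)
qed

text \<open>
  Surjectivity is the form of full row rank that passes at once to a block of rows: a target for the
  block is padded with zeros.
\<close>

lemma full_row_rank_iff_surj: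
  fixes A :: "'a::field mat"
  assumes A: "A \<in> carrier_mat m n"
  shows "vec_space.rank m A = m \<longleftrightarrow> (\<forall>y \<in> carrier_vec m. \<exists>v \<in> carrier_vec n. A *\<^sub>v v = y)"
proof -
  interpret vec_space "TYPE('a)" m .
  show ?thesis
    using A unfolding rank_eq_dim_iff_col_space[OF A] col_space_eq[OF A] by auto
qed

text \<open>
  If \<open>A v\<close> is the unit vector \<open>i\<close>, then \<open>w\<^sub>i = w \<bullet> A v = A\<^sup>T w \<bullet> v\<close>, so every coordinate of \<open>w\<close> can
  be recovered from \<open>A\<^sup>T w\<close>.
\<close>

lemma inj_on_transpose_if_surj:
  fixes A :: "'a::field mat"
  assumes A: "A \<in> carrier_mat m n"
    and surj: "\<forall>y \<in> carrier_vec m. \<exists>v \<in> carrier_vec n. A *\<^sub>v v = y"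
  shows "inj_on (\<lambda>y. A\<^sup>T *\<^sub>v y) (carrier_vec m)"
proof (rule inj_onI)
  fix y z
  assume y: "y \<in> carrier_vec m" and z: "z \<in> carrier_vec m" and eq: "A\<^sup>T *\<^sub>v y = A\<^sup>T *\<^sub>v z"
  show "y = z"
  proof (rule eq_vecI)
    fix i assume "i < dim_vec z"
    then have i: "i < m"
      using z by auto
    obtain v where v: "v \<in> carrier_vec n" and Av: "A *\<^sub>v v = unit_vec m i"
      using surj unit_vec_carrier by blast
    have *: "w $ i = (A\<^sup>T *\<^sub>v w) \<bullet> v" if w: "w \<in> carrier_vec m" for w
    proof -
      have "w $ i = w \<bullet> (A *\<^sub>v v)"
        unfolding Av using w i by (simp add: scalar_prod_right_unit)
      also have "\<dots> = (A\<^sup>T *\<^sub>v w) \<bullet> v"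
        using transpose_vec_mult_scalar[OF A v w] by simp
      finally show ?thesis .
    qed
    show "y $ i = z $ i"
      using *[OF y] *[OF z] eq by simp
  qed (use y z in auto)
qed

lemma card_carrier_vec_power:
  assumes "finite (UNIV :: 'a set)"
  shows "finite (carrier_vec k :: 'a vec set)" and "card (carrier_vec k :: 'a vec set) = CARD('a) ^ k"
proof -
  have bij: "bij_betw (vec k) ({..<k} \<rightarrow>\<^sub>E (UNIV :: 'a set)) (carrier_vec k)"
  proof (rule bij_betwI[where g = "\<lambda>v. restrict (($) v) {..<k}"])
    show "restrict (($) (vec k f)) {..<k} = f" if "f \<in> {..<k} \<rightarrow>\<^sub>E UNIV" for f :: "nat \<Rightarrow> 'a"
      using that by (auto simp: fun_eq_iff PiE_def extensional_def)
  qed auto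
  show "finite (carrier_vec k :: 'a vec set)"
    using bij_betw_finite[OF bij] finite_PiE[of "{..<k}" "\<lambda>_. UNIV :: 'a set"] assms by simp
  show "card (carrier_vec k :: 'a vec set) = CARD('a) ^ k"
    using bij_betw_same_card[OF bij] by (simp add: card_PiE)
qed

lemma ex_bij_betw_lessThan_start:
  assumes "finite M" and "a \<in> M"
  shows "\<exists>x. bij_betw x {..<card M} M \<and> x 0 = a"
proof -
  \<comment> \<open>Exchange the index of \<open>a\<close> in some enumeration with the index \<open>0\<close>.\<close>
  obtain h where h: "bij_betw h {..<card M} M"
    using ex_bij_betw_nat_finite[OF assms(1)] by (auto simp: lessThan_atLeast0)
  then obtain k where k: "k < card M" "h k = a"
    using assms(2) by (metis bij_betw_imp_surj_on imageE lessThan_iff)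
  have "bij_betw (Transposition.transpose 0 k) {..<card M} {..<card M}"
    using k by (intro bij_betwI[where g = "Transposition.transpose 0 k"])
      (auto simp: Transposition.transpose_def)
  then have "bij_betw (h \<circ> Transposition.transpose 0 k) {..<card M} M"
    using h by (rule bij_betw_trans)
  then show ?thesis
    using k by (intro exI[of _ "h \<circ> Transposition.transpose 0 k"]) simp
qed

text \<open>
  The row space is the image of \<open>y \<mapsto> A\<^sup>T y\<close>, which is injective here, so it has as many
  elements as there are coefficient vectors \<open>y\<close>.
\<close>

lemma ex_enum_row_space:
  fixes A :: "'a::field mat"
  assumes finite_field: "finite (UNIV :: 'a set)" and A: "A \<in> carrier_mat k n"
    and surj: "\<forall>y \<in> carrier_vec k. \<exists>v \<in> carrier_vec n. A *\<^sub>v v = y"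
  shows "\<exists>x. bij_betw x {..<CARD('a) ^ k} (vec_space.row_space n A) \<and> x 0 = 0\<^sub>v n"
proof -
  interpret vec_space "TYPE('a)" n .
  have im: "row_space A = (\<lambda>y. A\<^sup>T *\<^sub>v y) ` carrier_vec k"
    using A unfolding row_space_eq[OF A] by auto
  have "A\<^sup>T *\<^sub>v 0\<^sub>v k = 0\<^sub>v n"
    using A by (intro eq_vecI) auto
  then have "0\<^sub>v n \<in> row_space A"
    unfolding im by (metis imageI zero_carrier_vec)
  moreover have "card (row_space A) = CARD('a) ^ k"
    unfolding im using card_image[OF inj_on_transpose_if_surj[OF A surj]]
    using card_carrier_vec_power(2)[OF finite_field] by (rule trans)
  moreover have "finite (row_space A)"
    unfolding im using card_carrier_vec_power(1)[OF finite_field] by blast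
  ultimately show ?thesis
    using ex_bij_betw_lessThan_start by metis
qed

lemma array_generator_yields_design:
  fixes G :: "'a::field mat"
  assumes finite_field: "finite (UNIV :: 'a set)" and gen: "array_generator p q n G"
  shows "\<exists>d. yields_design p q n G d"
proof -
  have G: "G \<in> carrier_mat (p + q) n" and rank: "vec_space.rank (p + q) G = p + q"
    using gen by (auto simp: array_generator_def)
  have surj: "\<exists>v \<in> carrier_vec n. G *\<^sub>v v = y" if "y \<in> carrier_vec (p + q)" for y
    using rank that unfolding full_row_rank_iff_surj[OF G] by blast
  have c: "gen_c p G \<in> carrier_mat p n" and r: "gen_r p G \<in> carrier_mat q n"
    using G by (auto simp: gen_c_def gen_r_def)
  have "\<exists>v \<in> carrier_vec n. gen_c p G *\<^sub>v v = y" if y: "y \<in> carrier_vec p" for y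
  proof -
    obtain v where v: "v \<in> carrier_vec n" and Gv: "G *\<^sub>v v = y @\<^sub>v 0\<^sub>v q"
      using surj[of "y @\<^sub>v 0\<^sub>v q"] y by auto
    have "gen_c p G *\<^sub>v v = y"
    proof (rule eq_vecI)
      fix i assume "i < dim_vec y"
      then have i: "i < p"
        using y by auto
      have "row (gen_c p G) i = row G i"
        using i G by (intro eq_vecI) (auto simp: gen_c_def)
      then show "(gen_c p G *\<^sub>v v) $ i = y $ i"
        using arg_cong[OF Gv, of "\<lambda>w. w $ i"] i G c y by auto
    qed (use c y in auto)
    then show ?thesis
      using v by blast
  qed
  moreover have "\<exists>v \<in> carrier_vec n. gen_r p G *\<^sub>v v = y" if y: "y \<in> carrier_vec q" for y
  proof -
    obtain v where v: "v \<in> carrier_vec n" and Gv: "G *\<^sub>v v = 0\<^sub>v p @\<^sub>v y"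
      using surj[of "0\<^sub>v p @\<^sub>v y"] y by auto
    have "gen_r p G *\<^sub>v v = y"
    proof (rule eq_vecI)
      fix i assume "i < dim_vec y"
      then have i: "i < q"
        using y by auto
      have "row (gen_r p G) i = row G (p + i)"
        using i G by (intro eq_vecI) (auto simp: gen_r_def)
      then show "(gen_r p G *\<^sub>v v) $ i = y $ i"
        using arg_cong[OF Gv, of "\<lambda>w. w $ (p + i)"] i G r y by auto
    qed (use r y in auto)
    then show ?thesis
      using v by blast
  qed
  ultimately obtain x y where
    "bij_betw x {..<CARD('a) ^ p} (vec_space.row_space n (gen_c p G))" "x 0 = 0\<^sub>v n"
    "bij_betw y {..<CARD('a) ^ q} (vec_space.row_space n (gen_r p G))" "y 0 = 0\<^sub>v n"
    using ex_enum_row_space[OF finite_field c] ex_enum_row_space[OF finite_field r] by blast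
  then show ?thesis
    unfolding yields_design_def by (intro exI[of _ "\<lambda>i j. x i + y j"] exI[of _ x] exI[of _ y]) simp
qed

section \<open>Confounding in designs with a one-row column block\<close>

text \<open>
  Two scalars \<open>a, b\<close> satisfy \<open>b * a - a * b = 0\<close>, which is a dependence unless both vanish.
\<close>

lemma cols_dependent_one_row:
  fixes A :: "'a::field mat"
  assumes "dim_row A = 1" and "i \<noteq> j"
  shows "cols_dependent A {i, j}"
proof (cases "A $$ (0, i) = 0 \<and> A $$ (0, j) = 0")
  case True
  then show ?thesis
    using assms unfolding cols_dependent_def by (intro exI[of _ "\<lambda>_. 1"]) auto
next
  case False
  then show ?thesis
    using assms unfolding cols_dependent_def
    by (intro exI[of _ "\<lambda>k. if k = i then A $$ (0, j) else - A $$ (0, i)"]) auto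
qed

lemma no_unconfounded_2fis_one_row:
  "num_unconfounded_2fis 1 n (G :: 'a::field mat) = 0"
proof -
  have "\<not> unconfounded 1 n G E" if E: "E \<in> two_fis n" for E
  proof -
    obtain i j where ij: "i \<noteq> j" "E = {i, j}"
      using E by (auto simp: two_fis_def)
    have "cols_dependent (gen_c 1 G) {i, j}"
      by (rule cols_dependent_one_row) (auto simp: gen_c_def ij)
    then show ?thesis
      using ij by (auto simp: unconfounded_def confounded_col_effects_def)
  qed
  then have "{E \<in> two_fis n. unconfounded 1 n G E} = {}"
    by blast
  then show ?thesis
    unfolding num_unconfounded_2fis_def by (simp only: card.empty)
qed

text \<open>
  Over \<open>GF(2)\<close> a dependence is a nonempty set \<open>S\<close> of columns with sum zero. The row of ones forces
  \<open>S\<close> to have an even number of elements, hence exactly two, and two columns with sum zero are equal.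
\<close>

lemma at_most_three_cols_independent:
  fixes G :: "bit mat"
  assumes I: "finite I" "card I \<le> 3" "0 < dim_row G"
    and ones: "\<And>i. i \<in> I \<Longrightarrow> G $$ (0, i) = 1"
    and distinct: "\<And>i j. i \<in> I \<Longrightarrow> j \<in> I \<Longrightarrow> i \<noteq> j \<Longrightarrow> \<exists>r < dim_row G. G $$ (r, i) \<noteq> G $$ (r, j)"
  shows "\<not> cols_dependent G I"
proof
  assume "cols_dependent G I"
  then obtain c where c: "\<exists>i\<in>I. c i \<noteq> 0"
    and sum: "\<And>r. r < dim_row G \<Longrightarrow> (\<Sum>i\<in>I. c i * G $$ (r, i)) = 0"
    unfolding cols_dependent_def by blast
  define S where "S = {i \<in> I. c i \<noteq> 0}"
  have S: "finite S" "S \<subseteq> I" "S \<noteq> {}"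
    using I c by (auto simp: S_def)
  have sumS: "(\<Sum>i\<in>S. G $$ (r, i)) = 0" if "r < dim_row G" for r
  proof -
    have "(\<Sum>i\<in>S. G $$ (r, i)) = (\<Sum>i\<in>I. c i * G $$ (r, i))"
      unfolding S_def using I by (intro sum.mono_neutral_cong_left) auto
    then show ?thesis
      using sum[OF that] by simp
  qed
  have "(\<Sum>i\<in>S. G $$ (0, i)) = of_nat (card S)"
    using S ones by (simp add: subset_iff)
  then have "(of_nat (card S) :: bit) = 0"
    using sumS[of 0] I by simp
  then have "even (card S)"
    by (metis bit_not_zero_iff even_of_nat_iff odd_one even_zero)
  moreover have "card S \<le> 3" "card S \<noteq> 0"
    using S I card_mono[of I S] by auto
  ultimately have "card S = 2"
    by presburger
  then obtain a b where ab: "S = {a, b}" "a \<noteq> b"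
    by (auto simp: card_2_iff)
  obtain r where "r < dim_row G" "G $$ (r, a) \<noteq> G $$ (r, b)"
    using distinct[of a b] ab S by auto
  then show False
    using sumS[of r] ab by (auto simp: add_eq_0_iff)
qed

lemma main_effects_unconfounded_one_row:
  fixes G :: "bit mat"
  assumes G: "G \<in> carrier_mat (1 + q) n"
    and ones: "\<And>i. i < n \<Longrightarrow> G $$ (0, i) = 1"
    and nz: "\<And>i. i < n \<Longrightarrow> \<exists>r < q. G $$ (1 + r, i) \<noteq> 0"
    and distinct: "\<And>i j. i < n \<Longrightarrow> j < n \<Longrightarrow> i \<noteq> j \<Longrightarrow> \<exists>r < 1 + q. G $$ (r, i) \<noteq> G $$ (r, j)"
  shows "main_effects_unconfounded 1 n G"
  unfolding main_effects_unconfounded_def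
proof
  fix E assume "E \<in> main_effects n"
  then obtain i where i: "i < n" "E = {i}"
    by (auto simp: main_effects_def)
  have "\<not> confounded G E E'" if E': "E' \<in> main_effects n \<union> two_fis n" for E'
  proof -
    have E'2: "finite E' \<and> card E' \<le> 2 \<and> E' \<subseteq> {..<n}"
      using E' by (auto simp: main_effects_def two_fis_def card_insert_if)
    then have "card (E \<union> E') \<le> 3"
      unfolding i by (simp add: card_insert_if)
    moreover have sub: "E \<union> E' \<subseteq> {..<n}"
      using E'2 i by auto
    ultimately show ?thesis
      unfolding confounded_def using E'2 i G ones distinct
      by (intro at_most_three_cols_independent) (auto simp: subset_iff)
  qed
  moreover have "\<not> confounded_col_effects 1 G E"
  proof -
    have "col (gen_c 1 G) i $ 0 = 1"
      using ones i G by (simp add: gen_c_def)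
    then show ?thesis
      unfolding confounded_col_effects_def i by (auto simp: doubleton_eq_iff)
  qed
  moreover have "\<not> confounded_row_effects 1 G E"
  proof -
    obtain r where r: "r < q" "G $$ (1 + r, i) \<noteq> 0"
      using nz i by blast
    then have "col (gen_r 1 G) i $ r \<noteq> 0"
      using i G by (simp add: gen_r_def)
    then show ?thesis
      unfolding confounded_row_effects_def i using r G by (auto simp: doubleton_eq_iff)
  qed
  ultimately show "unconfounded 1 n G E"
    unfolding unconfounded_def by blast
qed

section \<open>The matrix of the theorem\<close>

lemma one_row_generator_carrier: "one_row_generator q \<in> carrier_mat (1 + q) (q + 2)"
  by (auto simp: one_row_generator_def append_rows_def ones_mat_def four_block_mat_def Let_def)

lemma one_row_generator_index:
  assumes "i < 1 + q" and "j < q + 2"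
  shows "one_row_generator q $$ (i, j) =
    (if i = 0 \<or> j = 0 then 1 else if j \<le> q then (if i = j then 0 else 1) else if i = q then 1 else 0)"
  using assms
  by (auto simp: one_row_generator_def append_rows_def ones_mat_def ones_vec_def mat_of_cols_def
      nth_append nth_Cons' Let_def)

text \<open>
  The columns span all unit vectors: columns \<open>0\<close> and \<open>i\<close> differ only in row \<open>i\<close>, and the last
  column is the sum of the unit vectors \<open>0\<close> and \<open>q\<close>.
\<close>

lemma one_row_generator_rank:
  assumes q: "0 < q"
  shows "vec_space.rank (1 + q) (one_row_generator q) = 1 + q"
proof -
  interpret vec_space "TYPE(bit)" "1 + q" .
  let ?G = "one_row_generator q" and ?S = "col_space (one_row_generator q)"
  have G: "?G \<in> carrier_mat (1 + q) (q + 2)"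
    by (rule one_row_generator_carrier)
  have sub: "set (cols ?G) \<subseteq> carrier_vec (1 + q)"
    using cols_dim[of ?G] G by simp
  have add: "v + w \<in> ?S" if "v \<in> ?S" "w \<in> ?S" for v w
    using that span_add1[of "set (cols ?G)" v w] sub unfolding col_space_def by simp
  have col: "col ?G j \<in> ?S" if "j < q + 2" for j
    unfolding col_space_def using that G sub
    by (intro span_mem) (auto simp: cols_def simp del: upt_Suc)
  have unit: "unit_vec (1 + q) i \<in> ?S" if i: "0 < i" "i \<le> q" for i
  proof -
    have "unit_vec (1 + q) i = col ?G 0 + col ?G i"
      using i G by (intro eq_vecI) (auto simp: one_row_generator_index unit_vec_def)
    then show ?thesis
      using add col i by simp
  qed
  have "unit_vec (1 + q) 0 = col ?G (q + 1) + unit_vec (1 + q) q"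
    using q G by (intro eq_vecI) (auto simp: one_row_generator_index unit_vec_def)
  then have "unit_vec (1 + q) 0 \<in> ?S"
    using add col unit[of q] q by simp
  then have all: "unit_vec (1 + q) i \<in> ?S" if "i < 1 + q" for i
    using unit[of i] that by (cases "i = 0") simp_all
  have "set (unit_vecs (1 + q) :: bit vec list) \<subseteq> ?S"
  proof
    fix v :: "bit vec" assume "v \<in> set (unit_vecs (1 + q))"
    then obtain i where "i < 1 + q" "v = unit_vec (1 + q) i"
      unfolding unit_vecs_def by (auto simp del: upt_Suc)
    then show "v \<in> ?S"
      using all by simp
  qed
  then have "span (set (unit_vecs (1 + q))) \<subseteq> ?S"
    unfolding col_space_def by (rule span_subsetI[OF sub])
  then have "carrier_vec (1 + q) \<subseteq> ?S"
    unfolding span_unit_vecs_is_carrier .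
  moreover have "?S \<subseteq> carrier_vec (1 + q)"
    using G unfolding col_space_eq[OF G] by auto
  ultimately have "?S = carrier_vec (1 + q)"
    by (rule subset_antisym[rotated])
  then show ?thesis
    using rank_eq_dim_iff_col_space[OF G] by simp
qed

lemma one_row_generator_main_effects_unconfounded:
  assumes q: "3 \<le> q"
  shows "main_effects_unconfounded 1 (q + 2) (one_row_generator q)"
proof (rule main_effects_unconfounded_one_row[OF one_row_generator_carrier])
  show "one_row_generator q $$ (0, j) = 1" if "j < q + 2" for j
    using that by (simp add: one_row_generator_index)
  show "\<exists>r<q. one_row_generator q $$ (1 + r, j) \<noteq> 0" if j: "j < q + 2" for j
  \<comment> \<open>Below the first row, column \<open>j \<le> q\<close> is zero at most in row \<open>j\<close>, and the last column has its
     entry \<open>1\<close> in row \<open>q\<close>.\<close>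
  proof (cases "j = q")
    case True
    then show ?thesis
      using q by (intro exI[of _ 0]) (simp add: one_row_generator_index)
  next
    case False
    then show ?thesis
      using q j by (intro exI[of _ "q - 1"]) (simp add: one_row_generator_index)
  qed
  have *: "\<exists>r<1 + q. one_row_generator q $$ (r, i) \<noteq> one_row_generator q $$ (r, j)"
    if ij: "i < j" "j < q + 2" for i j
  proof (cases "j \<le> q")
    case True
    then show ?thesis
      using ij by (intro exI[of _ j]) (simp add: one_row_generator_index)
  next
    case False
    then have j: "j = q + 1"
      using ij by simp
    \<comment> \<open>The last column is zero in all rows strictly between \<open>0\<close> and \<open>q\<close>, while column \<open>i\<close> is
       zero in at most one of them; since \<open>q \<ge> 3\<close> there are at least two such rows.\<close>
    obtain r where r: "0 < r" "r < q" "r \<noteq> i"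
    proof (cases "i = 1")
      case True
      then show thesis
        using q that[of 2] by simp
    next
      case False
      then show thesis
        using q that[of 1] by simp
    qed
    then show ?thesis
      using ij j by (intro exI[of _ r]) (simp add: one_row_generator_index)
  qed
  show "\<exists>r<1 + q. one_row_generator q $$ (r, i) \<noteq> one_row_generator q $$ (r, j)"
    if "i < q + 2" "j < q + 2" "i \<noteq> j" for i j
    using *[of i j] *[of j i] that by (metis linorder_neqE_nat)
qed

theorem theorem5:
  fixes p q n :: nat
  assumes "p = 1" and "q \<ge> 3" and "n = p + q + 1"
  shows "(\<exists>d. yields_design p q n (one_row_generator q) d) \<and>
         fractional_factorial p q n 1 (one_row_generator q) \<and>
         two_fi_optimal p q n (one_row_generator q)"
proof -
  have p: "p = 1" and n: "n = q + 2"
    using assms by simp_all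
  have gen: "array_generator p q n (one_row_generator q)"
    using assms(2) one_row_generator_carrier[of q] one_row_generator_rank[of q]
    by (simp add: array_generator_def p n)
  have "(UNIV :: bit set) = {0, 1}"
    by (auto intro: bit.exhaust)
  then have "finite (UNIV :: bit set)"
    by (metis finite.emptyI finite.insertI)
  then have "\<exists>d. yields_design p q n (one_row_generator q) d"
    using gen by (rule array_generator_yields_design)
  moreover have "fractional_factorial p q n 1 (one_row_generator q)"
    using gen by (simp add: fractional_factorial_def p n)
  moreover have "two_fi_optimal p q n (one_row_generator q)"
    unfolding two_fi_optimal_def
    using gen one_row_generator_main_effects_unconfounded[OF assms(2)]
    by (simp only: p n no_unconfounded_2fis_one_row simp_thms order_refl)
  ultimately show ?thesis
    by blast
qed

end
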